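(* For any states $R$ and $S$ in the grand-potential resource theory defined by $(\beta,\mu)$, the following are equivalent: (a) $R\succ_{\beta,\mu}S$. (b) $L_R(t)\ge L_S(t)$ for all $t\in[0,1]$. (c) $\phi_{f_a}(R)\ge\phi_{f_a}(S)$ for every function $f_a(t)=\max\{0,t-a\}$ with $a\in\mathbb R$. (d) $\phi_f(R)\ge\phi_f(S)$ for all continuous convex functions $f:[0,\infty)\to\mathbb R$.
   Context: Fix real numbers $\beta,\mu$. A state is $R=(r,H,N)$, where $H$ (Hamiltonian) and $N$ (number operator) are commuting Hermitian operators on a $d_R$-dimensional Hilbert space and $r$ is a probability vector: the vector of eigenvalues, in a common eigenbasis of $H$ and $N$, of a density operator commuting with $H$ and $N$. The associated equilibrium state is $G_R=(g_R,H,N)$, where $g_R$ has entries $e^{-\beta(E_i-\mu n_i)}/Z$, with $E_i,n_i$ the eigenvalues of $H,N$ on the $i$th common eigenvector and $Z=\sum_i e^{-\beta(E_i-\mu n_i)}$. Equimajorization: $R\succ_{\beta,\mu}S$, for $R=(r,H_R,N_R)$ and $S=(s,H_S,N_S)$, means there is a $d_S\times d_R$ stochastic matrix $M$ (nonnegative entries, $\sum_{i=1}^{d_S}M_{ij}=1$ for every $j$) with $Mr=s$ and $Mg_R=g_S$. $f$-divergence: $\phi_f(R)=\sum_{i=1}^{d_R}g_i\,f(r_i/g_i)$, where $g_i$ is the $i$th entry of $g_R$. Rescaled Lorenz curve: $L_R:[0,1]\to[0,1]$ is the piecewise linear function connecting the points $(t_k,L_R(t_k))$, $k=0,\dots,d_R$,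 with $(t_0,L_R(t_0))=(0,0)$ and $(t_k,L_R(t_k))=\left(\sum_{j=1}^k g_{\pi(j)},\sum_{j=1}^k r_{\pi(j)}\right)$ for $k\ge1$, where $\pi$ is a permutation such that the sequence $(r_{\pi(j)}/g_{\pi(j)})_j$ is nonincreasing. *)

theory Defs
  imports
    "HOL-Analysis.Convex"
    "HOL-Combinatorics.Permutations"
    "Jordan_Normal_Form.Schur_Decomposition"
begin

definition hermitian_mat :: "complex mat \<Rightarrow> bool" where
  "hermitian_mat A \<longleftrightarrow> A \<in> carrier_mat (dim_row A) (dim_row A) \<and> mat_adjoint A = A"

definition mat_trace :: "'a::comm_monoid_add mat \<Rightarrow> 'a" where
  "mat_trace A = (\<Sum>i<dim_row A. A $$ (i, i))"

(* The order on complex numbers is the usual partial one, so that 0 \<le> z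
   says that z is real and nonnegative. *)
definition density_operator :: "nat \<Rightarrow> complex mat \<Rightarrow> bool" where
  "density_operator d \<rho> \<longleftrightarrow>
     \<rho> \<in> carrier_mat d d \<and> hermitian_mat \<rho> \<and>
     (\<forall>v \<in> carrier_vec d. 0 \<le> (\<rho> *\<^sub>v v) \<bullet>c v) \<and> mat_trace \<rho> = 1"

definition orthonormal_basis :: "nat \<Rightarrow> (nat \<Rightarrow> complex vec) \<Rightarrow> bool" where
  "orthonormal_basis d u \<longleftrightarrow>
     (\<forall>i<d. u i \<in> carrier_vec d) \<and>
     (\<forall>i<d. \<forall>j<d. u i \<bullet>c u j = (if i = j then 1 else 0))"

(* The common eigenbasis is part of the data, because it is what pairs the entries
   of the probability vector with the eigenvalues of the two operators. All indices
   run over {..<d}; the values of eigbasis at other indices are irrelevant. *)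
record gp_state =
  probs :: "real vec"
  ham :: "complex mat"
  num :: "complex mat"
  eigbasis :: "nat \<Rightarrow> complex vec"

definition gp_dim :: "gp_state \<Rightarrow> nat" where
  "gp_dim R = dim_vec (probs R)"

definition probability_vec :: "real vec \<Rightarrow> bool" where
  "probability_vec r \<longleftrightarrow> (\<forall>i<dim_vec r. 0 \<le> r $ i) \<and> (\<Sum>i<dim_vec r. r $ i) = 1"

definition is_state :: "gp_state \<Rightarrow> bool" where
  "is_state R \<longleftrightarrow> (let d = gp_dim R; r = probs R; H = ham R; N = num R; u = eigbasis R in
     H \<in> carrier_mat d d \<and> hermitian_mat H \<and>
     N \<in> carrier_mat d d \<and> hermitian_mat N \<and>
     H * N = N * H \<and>
     orthonormal_basis d u \<and>
     (\<forall>i<d. \<exists>E::real. eigenvector H (u i) (complex_of_real E)) \<and>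
     (\<forall>i<d. \<exists>n::real. eigenvector N (u i) (complex_of_real n)) \<and>
     probability_vec r \<and>
     (\<exists>\<rho>. density_operator d \<rho> \<and> \<rho> * H = H * \<rho> \<and> \<rho> * N = N * \<rho> \<and>
          (\<forall>i<d. eigenvector \<rho> (u i) (complex_of_real (r $ i)))))"

definition energy :: "gp_state \<Rightarrow> nat \<Rightarrow> real" where
  "energy R i = (THE E. eigenvector (ham R) (eigbasis R i) (complex_of_real E))"

definition number :: "gp_state \<Rightarrow> nat \<Rightarrow> real" where
  "number R i = (THE n. eigenvector (num R) (eigbasis R i) (complex_of_real n))"

definition partition_fun :: "real \<Rightarrow> real \<Rightarrow> gp_state \<Rightarrow> real" where
  "partition_fun \<beta> \<mu> R = (\<Sum>i<gp_dim R. exp (- \<beta> * (energy R i - \<mu> * number R i)))"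

definition gibbs_vec :: "real \<Rightarrow> real \<Rightarrow> gp_state \<Rightarrow> real vec" where
  "gibbs_vec \<beta> \<mu> R =
     vec (gp_dim R) (\<lambda>i. exp (- \<beta> * (energy R i - \<mu> * number R i)) / partition_fun \<beta> \<mu> R)"

definition stochastic_mat :: "real mat \<Rightarrow> bool" where
  "stochastic_mat M \<longleftrightarrow>
     (\<forall>i<dim_row M. \<forall>j<dim_col M. 0 \<le> M $$ (i, j)) \<and>
     (\<forall>j<dim_col M. (\<Sum>i<dim_row M. M $$ (i, j)) = 1)"

definition equimajorizes :: "real \<Rightarrow> real \<Rightarrow> gp_state \<Rightarrow> gp_state \<Rightarrow> bool" where
  "equimajorizes \<beta> \<mu> R S \<longleftrightarrow>
     (\<exists>M \<in> carrier_mat (gp_dim S) (gp_dim R). stochastic_mat M \<and>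
        M *\<^sub>v probs R = probs S \<and> M *\<^sub>v gibbs_vec \<beta> \<mu> R = gibbs_vec \<beta> \<mu> S)"

definition f_divergence :: "real \<Rightarrow> real \<Rightarrow> (real \<Rightarrow> real) \<Rightarrow> gp_state \<Rightarrow> real" where
  "f_divergence \<beta> \<mu> f R =
     (\<Sum>i<gp_dim R. gibbs_vec \<beta> \<mu> R $ i * f (probs R $ i / gibbs_vec \<beta> \<mu> R $ i))"

(* Indices are shifted by one: the sequence is \<pi> 0, ..., \<pi> (d - 1). *)
definition sorting_perm :: "real \<Rightarrow> real \<Rightarrow> gp_state \<Rightarrow> (nat \<Rightarrow> nat) \<Rightarrow> bool" where
  "sorting_perm \<beta> \<mu> R \<pi> \<longleftrightarrow> \<pi> permutes {..<gp_dim R} \<and>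
     (\<forall>i j. i \<le> j \<and> j < gp_dim R \<longrightarrow>
        probs R $ \<pi> j / gibbs_vec \<beta> \<mu> R $ \<pi> j \<le> probs R $ \<pi> i / gibbs_vec \<beta> \<mu> R $ \<pi> i)"

(* The piecewise linear function through the points (x k, y k), k = 0, ..., d, for
   increasing x 0 < ... < x d and an argument t in the interval [x 0, x d]: k below
   is the index of the segment [x k, x (Suc k)] that contains t. *)
definition piecewise_linear :: "(nat \<Rightarrow> real) \<Rightarrow> (nat \<Rightarrow> real) \<Rightarrow> real \<Rightarrow> real" where
  "piecewise_linear x y t = (let k = (LEAST k. t \<le> x (Suc k)) in
     y k + (t - x k) / (x (Suc k) - x k) * (y (Suc k) - y k))"

(* Different sorting permutations only reorder knots lying on a common line segment,
   so the curve does not depend on the choice. It is used on [0, 1] only. *)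
definition lorenz_curve :: "real \<Rightarrow> real \<Rightarrow> gp_state \<Rightarrow> real \<Rightarrow> real" where
  "lorenz_curve \<beta> \<mu> R = (let \<pi> = (SOME \<pi>. sorting_perm \<beta> \<mu> R \<pi>) in
     piecewise_linear (\<lambda>k. \<Sum>j<k. gibbs_vec \<beta> \<mu> R $ \<pi> j) (\<lambda>k. \<Sum>j<k. probs R $ \<pi> j))"

lemma sorting_perm_exists: "\<exists>\<pi>. sorting_perm \<beta> \<mu> R \<pi>"
proof -
  define d where "d = gp_dim R"
  define q where "q i = probs R $ i / gibbs_vec \<beta> \<mu> R $ i" for i
  define xs where "xs = sort_key (\<lambda>i. - q i) [0..<d]"
  have xs: "distinct xs" "set xs = {..<d}" "length xs = d"
    by (auto simp: xs_def)
  define \<pi> where "\<pi> i = (if i < d then xs ! i else i)" for i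
  have "bij_betw ((!) xs) {..<d} {..<d}"
    by (rule bij_betw_nth) (simp_all only: xs)
  then have "bij_betw \<pi> {..<d} {..<d}"
    by (subst bij_betw_cong[where g = "(!) xs"]) (simp_all add: \<pi>_def)
  then have perm: "\<pi> permutes {..<d}"
    by (rule bij_imp_permutes) (simp add: \<pi>_def)
  have "sorted (map (\<lambda>i. - q i) xs)"
    by (simp add: xs_def)
  then have "q (\<pi> j) \<le> q (\<pi> i)" if "i \<le> j" "j < d" for i j
    using that xs(3) sorted_nth_mono[of "map (\<lambda>i. - q i) xs" i j] by (simp add: \<pi>_def)
  with perm show ?thesis
    unfolding sorting_perm_def d_def q_def by blast
qed

lemma piecewise_linear_segment:
  assumes x: "strict_mono_on {..d} x" and k: "k < d" and t: "x k \<le> t" "t \<le> x (Suc k)"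
  shows "piecewise_linear x y t = y k + (t - x k) / (x (Suc k) - x k) * (y (Suc k) - y k)"
proof -
  define l where "l = (LEAST l. t \<le> x (Suc l))"
  have l: "t \<le> x (Suc l)" "l \<le> k"
    unfolding l_def by (rule LeastI[of "\<lambda>l. t \<le> x (Suc l)" k, OF t(2)], rule Least_le, rule t(2))
  have mono: "x i < x j" if "i < j" "j \<le> d" for i j
    by (rule strict_mono_onD[OF x]) (use that in simp_all)
  show ?thesis
  proof (cases "l = k")
    case True
    then show ?thesis unfolding piecewise_linear_def Let_def l_def[symmetric] by simp
  next
    case False
    have "\<not> Suc l < k"
    proof
      assume "Suc l < k"
      then have "x (Suc l) < x k" using mono k by (meson less_imp_le)
      then show False using l(1) t(1) by linarith
    qed
    with False l(2) have lk: "k = Suc l" by linarith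
    have "t = x k" using l(1) t(1) unfolding lk by (rule order_antisym)
    moreover have "x k - x l \<noteq> 0" using mono[of l k] k lk by fastforce
    ultimately show ?thesis
      unfolding piecewise_linear_def Let_def l_def[symmetric] by (simp add: lk)
  qed
qed

end

theory Submission
  imports Defs "HOL-Analysis.Function_Topology"
begin

text \<open>
  Jensen's inequality, applied to each row of a stochastic matrix, makes every
  \<open>f\<close>-divergence monotone under equimajorization. Conversely, on the finitely many ratios
  \<open>r\<^sub>i / g\<^sub>i\<close> and \<open>s\<^sub>i / h\<^sub>i\<close> a convex function is an affine function plus a nonnegative
  combination of hinges \<open>max 0 (t - a)\<close>, and affine functions have equal divergences, so the
  hinges control all convex functions. A stochastic matrix minimizing the squared distance from
  its images of \<open>(r, g)\<close> to \<open>(s, h)\<close> must attain distance \<open>0\<close>: otherwise the residual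
  \<open>y\<close> would separate \<open>(s, h)\<close> from all images, and the maximum of the affine functions
  with the coefficients \<open>y\<close> would be a convex function violating monotonicity. Finally, the
  hinge divergences and the Lorenz curve determine each other by Legendre duality: the divergence
  at \<open>a\<close> is the maximum of \<open>L t - a * t\<close>.
\<close>

section \<open>Convex functions on finite sets and hinges\<close>

text \<open>Between \<open>x j\<close> and \<open>x (Suc j)\<close> the hinge at
  \<open>x (Suc k)\<close> grows by the whole gap if \<open>k < j\<close> and not at all otherwise,
  so only the slope increments below \<open>j\<close> survive and telescope.\<close>

lemma sum_telescope_hinge:
  fixes x s :: "nat \<Rightarrow> real"
  assumes x: "strict_mono_on {..<N} x" and j: "Suc j < N"
  shows "(\<Sum>k<N - 2. (s (Suc k) - s k) * (max 0 (x (Suc j) - x (Suc k)) - max 0 (x j - x (Suc k))))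
     = (s j - s 0) * (x (Suc j) - x j)"
proof -
  have mono: "x a \<le> x b" if "a \<le> b" "b < N" for a b
    using strict_mono_onD[OF x, of a b] that by (cases "a = b") auto
  have "(\<Sum>k<N - 2. (s (Suc k) - s k) * (max 0 (x (Suc j) - x (Suc k)) - max 0 (x j - x (Suc k))))
      = (\<Sum>k<N - 2. if k \<in> {..<j} then (s (Suc k) - s k) * (x (Suc j) - x j) else 0)"
  proof (rule sum.cong[OF refl], goal_cases)
    case (1 k)
    show ?case
    proof (cases "k < j")
      case True
      then have "x (Suc k) \<le> x j" "x j \<le> x (Suc j)" using mono j by auto
      with True show ?thesis by (simp add: max_def)
    next
      case False
      with 1 have "x (Suc j) \<le> x (Suc k)" "x j \<le> x (Suc j)" using mono j by auto
      with False show ?thesis by (simp add: max_def)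
    qed
  qed
  also have "\<dots> = (\<Sum>k\<in>{..<N - 2} \<inter> {..<j}. (s (Suc k) - s k) * (x (Suc j) - x j))"
    by (simp add: sum.inter_restrict)
  also have "{..<N - 2} \<inter> {..<j} = {..<j}" using j by auto
  also have "(\<Sum>k<j. (s (Suc k) - s k) * (x (Suc j) - x j)) = (s j - s 0) * (x (Suc j) - x j)"
    by (simp add: sum_distrib_right[symmetric] sum_lessThan_telescope)
  finally show ?thesis .
qed

text \<open>The piecewise linear interpolant of \<open>f\<close> through the points of
  \<open>T\<close> is its first chord, extended to a line, plus one hinge at each interior point.
  The coefficient there is the jump in slope, which convexity makes nonnegative.\<close>

lemma convex_on_finite_hinges:
  fixes f :: "real \<Rightarrow> real"
  assumes f: "convex_on S f" and T: "finite T" "T \<subseteq> S"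
  obtains b m :: real and A :: "nat set" and c p :: "nat \<Rightarrow> real"
  where "finite A" "\<forall>k\<in>A. 0 \<le> c k"
    "\<forall>t\<in>T. f t = b + m * t + (\<Sum>k\<in>A. c k * max 0 (t - p k))"
proof -
  define N where "N = card T"
  define x where "x = (!) (sorted_list_of_set T)"
  define s where "s k = (f (x (Suc k)) - f (x k)) / (x (Suc k) - x k)" for k
  have x: "strict_mono_on {..<N} x"
    unfolding x_def N_def
    by (intro strict_mono_onI) (simp add: sorted_wrt_nth_less)
  have xT: "x k \<in> T" if "k < N" for k
    using that nth_mem[of k "sorted_list_of_set T"] T(1) by (simp add: x_def N_def)
  have Tx: "\<exists>k<N. t = x k" if "t \<in> T" for t
    using that T(1) by (metis in_set_conv_nth length_sorted_list_of_set set_sorted_list_of_set x_def N_def)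
  have lt: "x k < x (Suc k)" if "Suc k < N" for k
    using strict_mono_onD[OF x, of k "Suc k"] that by simp
  have c: "0 \<le> s (Suc k) - s k" if "k < N - 2" for k
  proof -
    have k: "Suc (Suc k) < N" using that by simp
    have "(f (x k) - f (x (Suc k))) / (x k - x (Suc k)) \<le> (f (x k) - f (x (Suc (Suc k)))) / (x k - x (Suc (Suc k)))"
      "(f (x k) - f (x (Suc (Suc k)))) / (x k - x (Suc (Suc k))) \<le> (f (x (Suc k)) - f (x (Suc (Suc k)))) / (x (Suc k) - x (Suc (Suc k)))"
      using convex_on_slope_le[OF f, of "x k" "x (Suc (Suc k))" "x (Suc k)"] xT T(2) lt k
      by (auto simp: subset_iff)
    then show ?thesis
      unfolding s_def
      by (metis diff_ge_0_iff_ge minus_diff_eq minus_divide_divide order_trans)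
  qed
  \<comment> \<open>The hinges sit at the interior points \<open>x 1\<close>, ...,
    \<open>x (N - 2)\<close>. If \<open>T\<close> has fewer than two points, \<open>s 0\<close> is
    an arbitrary value, but it cancels at \<open>x 0\<close>.\<close>
  define P where "P t = (f (x 0) - s 0 * x 0) + s 0 * t
    + (\<Sum>k<N - 2. (s (Suc k) - s k) * max 0 (t - x (Suc k)))" for t
  have P: "f (x j) = P (x j)" if "j < N" for j
    using that
  proof (induction j)
    case 0
    have "x 0 \<le> x (Suc k)" if "k < N - 2" for k
      using strict_mono_onD[OF x, of 0 "Suc k"] that by (intro less_imp_le) auto
    then have "(\<Sum>k<N - 2. (s (Suc k) - s k) * max 0 (x 0 - x (Suc k))) = 0"
      by (intro sum.neutral) auto
    then show ?case by (simp add: P_def)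
  next
    case (Suc j)
    have "P (x (Suc j)) - P (x j) = s 0 * (x (Suc j) - x j)
        + (\<Sum>k<N - 2. (s (Suc k) - s k) * (max 0 (x (Suc j) - x (Suc k)) - max 0 (x j - x (Suc k))))"
      by (simp add: P_def right_diff_distrib sum_subtractf)
    also have "\<dots> = s j * (x (Suc j) - x j)"
      unfolding sum_telescope_hinge[OF x Suc.prems] by (simp add: algebra_simps)
    also have "\<dots> = f (x (Suc j)) - f (x j)"
      using lt[OF Suc.prems] by (simp add: s_def)
    finally show ?case using Suc by simp
  qed
  have "\<forall>t\<in>T. f t = P t" using Tx P by auto
  note rep = this[unfolded P_def]
  show ?thesis
    by (rule that[of "{..<N - 2}", OF _ _ rep]) (use c in auto)
qed

text \<open>The weight \<open>g j\<close> cancels the denominator of the ratio, so the affine part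
  of \<open>f\<close> contributes only through the totals of \<open>g\<close> and
  \<open>r\<close>.\<close>

lemma divergence_hinge_expansion:
  fixes r g :: "'j \<Rightarrow> real"
  assumes g: "\<And>j. j \<in> J \<Longrightarrow> 0 < g j"
    and f: "\<And>j. j \<in> J \<Longrightarrow>
      f (r j / g j) = b + m * (r j / g j) + (\<Sum>k\<in>A. c k * max 0 (r j / g j - p k))"
  shows "(\<Sum>j\<in>J. g j * f (r j / g j)) = b * sum g J + m * sum r J
      + (\<Sum>k\<in>A. c k * (\<Sum>j\<in>J. g j * max 0 (r j / g j - p k)))"
proof -
  have "(\<Sum>j\<in>J. g j * f (r j / g j))
      = (\<Sum>j\<in>J. b * g j + m * r j + (\<Sum>k\<in>A. c k * (g j * max 0 (r j / g j - p k))))"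
  proof (rule sum.cong[OF refl])
    fix j assume j: "j \<in> J"
    have "g j * (m * (r j / g j)) = m * r j" using g[OF j] by simp
    then show "g j * f (r j / g j)
        = b * g j + m * r j + (\<Sum>k\<in>A. c k * (g j * max 0 (r j / g j - p k)))"
      by (simp add: f[OF j] distrib_left sum_distrib_left mult_ac)
  qed
  also have "\<dots> = b * sum g J + m * sum r J
      + (\<Sum>k\<in>A. c k * (\<Sum>j\<in>J. g j * max 0 (r j / g j - p k)))"
    by (simp add: sum.distrib sum_distrib_left) (rule sum.swap)
  finally show ?thesis .
qed

lemma divergence_le_if_hinges_le:
  fixes r g :: "'j \<Rightarrow> real" and s h :: "'i \<Rightarrow> real"
  assumes fin: "finite J" "finite I"
    and r: "\<And>j. j \<in> J \<Longrightarrow> 0 \<le> r j" and g: "\<And>j. j \<in> J \<Longrightarrow> 0 < g j"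
    and s: "\<And>i. i \<in> I \<Longrightarrow> 0 \<le> s i" and h: "\<And>i. i \<in> I \<Longrightarrow> 0 < h i"
    and eq: "sum s I = sum r J" "sum h I = sum g J"
    and hinge: "\<And>a. (\<Sum>i\<in>I. h i * max 0 (s i / h i - a)) \<le> (\<Sum>j\<in>J. g j * max 0 (r j / g j - a))"
    and f: "convex_on {0..} f"
  shows "(\<Sum>i\<in>I. h i * f (s i / h i)) \<le> (\<Sum>j\<in>J. g j * f (r j / g j))"
proof -
  \<comment> \<open>The ratios of both pairs are collected, so that one expansion, with the same
    coefficients, serves both divergences. Their affine parts then agree by
    \<open>eq\<close>.\<close>
  define T where "T = (\<lambda>j. r j / g j) ` J \<union> (\<lambda>i. s i / h i) ` I"
  have "finite T" "T \<subseteq> {0..}"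
    using fin r g s h by (auto simp: T_def intro!: divide_nonneg_pos)
  then obtain b m A c p where c: "\<forall>k\<in>A. 0 \<le> c k"
    and rep: "\<forall>t\<in>T. f t = b + m * t + (\<Sum>k\<in>(A :: nat set). c k * max 0 (t - p k))"
    by (rule convex_on_finite_hinges[OF f])
  have "(\<Sum>k\<in>A. c k * (\<Sum>i\<in>I. h i * max 0 (s i / h i - p k)))
      \<le> (\<Sum>k\<in>A. c k * (\<Sum>j\<in>J. g j * max 0 (r j / g j - p k)))"
    by (intro sum_mono mult_left_mono hinge c[rule_format])
  moreover have "(\<Sum>i\<in>I. h i * f (s i / h i)) = b * sum h I + m * sum s I
      + (\<Sum>k\<in>A. c k * (\<Sum>i\<in>I. h i * max 0 (s i / h i - p k)))"
    by (rule divergence_hinge_expansion) (auto simp: h rep T_def)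
  moreover have "(\<Sum>j\<in>J. g j * f (r j / g j)) = b * sum g J + m * sum r J
      + (\<Sum>k\<in>A. c k * (\<Sum>j\<in>J. g j * max 0 (r j / g j - p k)))"
    by (rule divergence_hinge_expansion) (auto simp: g rep T_def)
  ultimately show ?thesis by (simp add: eq)
qed

section \<open>Stochastic matrices\<close>

text \<open>For fixed \<open>i\<close>, the weights \<open>M i j * g j / h i\<close> sum to 1 and
  average the ratios \<open>r j / g j\<close> to \<open>s i / h i\<close>, so Jensen's inequality
  applies. Summing over \<open>i\<close> removes \<open>M\<close> because its columns sum to
  1.\<close>

lemma divergence_mono_stochastic:
  fixes M :: "'i \<Rightarrow> 'j \<Rightarrow> real"
  assumes fin: "finite J" "finite I"
    and M: "\<And>i j. i \<in> I \<Longrightarrow> j \<in> J \<Longrightarrow> 0 \<le> M i j" "\<And>j. j \<in> J \<Longrightarrow> (\<Sum>i\<in>I. M i j) = 1"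
    and r: "\<And>j. j \<in> J \<Longrightarrow> 0 \<le> r j" and g: "\<And>j. j \<in> J \<Longrightarrow> 0 < g j"
    and s: "\<And>i. i \<in> I \<Longrightarrow> s i = (\<Sum>j\<in>J. M i j * r j)"
    and h: "\<And>i. i \<in> I \<Longrightarrow> h i = (\<Sum>j\<in>J. M i j * g j)" "\<And>i. i \<in> I \<Longrightarrow> 0 < h i"
    and f: "convex_on {0..} f"
  shows "(\<Sum>i\<in>I. h i * f (s i / h i)) \<le> (\<Sum>j\<in>J. g j * f (r j / g j))"
proof -
  have "h i * f (s i / h i) \<le> (\<Sum>j\<in>J. M i j * (g j * f (r j / g j)))" if i: "i \<in> I" for i
  proof -
    \<comment> \<open>Otherwise \<open>h i\<close> would be an empty sum, contradicting its
      positivity.\<close>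
    have "J \<noteq> {}" using h[OF i] by auto
    define a where "a j = M i j * g j / h i" for j
    have hi: "h i \<noteq> 0" using h(2)[OF i] by simp
    have "f (\<Sum>j\<in>J. a j *\<^sub>R (r j / g j)) \<le> (\<Sum>j\<in>J. a j * f (r j / g j))"
    proof (rule convex_on_sum[OF fin(1) \<open>J \<noteq> {}\<close> f])
      show "sum a J = 1"
        using h(1)[OF i] hi by (simp add: a_def sum_divide_distrib[symmetric])
      show "0 \<le> a j" if "j \<in> J" for j
        using M(1)[OF i that] g[OF that] h(2)[OF i] by (simp add: a_def)
      show "r j / g j \<in> {0..}" if "j \<in> J" for j
        using r[OF that] g[OF that] by simp
    qed
    moreover have "(\<Sum>j\<in>J. a j *\<^sub>R (r j / g j)) = s i / h i"
    proof -
      have "a j *\<^sub>R (r j / g j) = M i j * r j / h i" if "j \<in> J" for j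
        using g[OF that] by (simp add: a_def)
      then show ?thesis by (simp add: s[OF i] sum_divide_distrib)
    qed
    ultimately have "h i * f (s i / h i) \<le> h i * (\<Sum>j\<in>J. a j * f (r j / g j))"
      using h(2)[OF i] by simp
    also have "\<dots> = (\<Sum>j\<in>J. M i j * (g j * f (r j / g j)))"
      using hi by (simp add: a_def sum_distrib_left mult.assoc)
    finally show ?thesis .
  qed
  then have "(\<Sum>i\<in>I. h i * f (s i / h i)) \<le> (\<Sum>i\<in>I. \<Sum>j\<in>J. M i j * (g j * f (r j / g j)))"
    by (rule sum_mono)
  also have "\<dots> = (\<Sum>j\<in>J. \<Sum>i\<in>I. M i j * (g j * f (r j / g j)))"
    by (rule sum.swap)
  also have "\<dots> = (\<Sum>j\<in>J. g j * f (r j / g j))"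
    by (rule sum.cong[OF refl]) (simp add: M(2) sum_distrib_right[symmetric])
  finally show ?thesis .
qed

text \<open>Matrices are functions on all index pairs, and values outside \<open>I\<close> and
  \<open>J\<close> are confined to the unit interval as well. The set is thus a closed part of a
  cube that is compact by Tychonoff's theorem.\<close>

definition stochastic_on :: "'i set \<Rightarrow> 'j set \<Rightarrow> ('i \<times> 'j \<Rightarrow> real) set" where
  "stochastic_on I J = {M. (\<forall>x. M x \<in> {0..1}) \<and> (\<forall>j\<in>J. (\<Sum>i\<in>I. M (i, j)) = 1)}"

lemma compact_stochastic_on: "compact (stochastic_on I J)"
proof -
  have "compactin (product_topology (\<lambda>_. euclidean) UNIV) (PiE UNIV (\<lambda>_ :: 'a \<times> 'b. {0..1::real}))"
    by (subst compactin_PiE) simp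
  then have "compact (PiE UNIV (\<lambda>_ :: 'a \<times> 'b. {0..1::real}))"
    by (simp add: euclidean_product_topology)
  moreover have "closed (\<Inter>j\<in>J. {M :: 'a \<times> 'b \<Rightarrow> real. (\<Sum>i\<in>I. M (i, j)) = 1})"
    by (intro closed_INT ballI closed_Collect_eq continuous_intros continuous_on_product_coordinates)
  ultimately have "compact (PiE UNIV (\<lambda>_. {0..1}) \<inter> (\<Inter>j\<in>J. {M :: 'a \<times> 'b \<Rightarrow> real. (\<Sum>i\<in>I. M (i, j)) = 1}))"
    by (rule compact_Int_closed)
  moreover have "PiE UNIV (\<lambda>_. {0..1}) \<inter> (\<Inter>j\<in>J. {M :: 'a \<times> 'b \<Rightarrow> real. (\<Sum>i\<in>I. M (i, j)) = 1})
      = stochastic_on I J"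
    by (auto simp: stochastic_on_def PiE_iff Pi_iff)
  ultimately show ?thesis by simp
qed

lemma stochastic_on_convex_comb:
  assumes "M \<in> stochastic_on I J" "M' \<in> stochastic_on I J" "0 \<le> e" "e \<le> 1"
  shows "(\<lambda>x. (1 - e) * M x + e * M' x) \<in> stochastic_on I J"
proof -
  have "(1 - e) * M x + e * M' x \<in> {0..1}" for x
  proof -
    have "M x \<in> {0..1}" "M' x \<in> {0..1}" using assms(1,2) unfolding stochastic_on_def by blast+
    with assms(3,4) show ?thesis by (simp add: convex_bound_le)
  qed
  moreover have "(\<Sum>i\<in>I. (1 - e) * M (i, j) + e * M' (i, j)) = 1" if "j \<in> J" for j
    using assms that by (simp add: stochastic_on_def sum.distrib sum_distrib_left[symmetric])
  ultimately show ?thesis by (simp add: stochastic_on_def)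
qed

text \<open>Dividing by \<open>e\<close> and letting \<open>e\<close> tend to 0 would give the
  claim; an explicit small \<open>e\<close> avoids the limit. The denominator \<open>C + 1\<close>
  stays positive when \<open>C\<close> is 0.\<close>

lemma first_order_condition:
  fixes B C :: real
  assumes C: "0 \<le> C" and le: "\<And>e. 0 < e \<Longrightarrow> e \<le> 1 \<Longrightarrow> 2 * e * B \<le> e\<^sup>2 * C"
  shows "B \<le> 0"
proof (rule ccontr)
  assume "\<not> B \<le> 0"
  then have B: "0 < B" by simp
  define e where "e = min 1 (B / (C + 1))"
  have e: "0 < e" "e \<le> 1" using B C by (auto simp: e_def)
  have "2 * e * B \<le> e * (e * C)" using le[OF e] by (simp add: power2_eq_square mult_ac)
  then have "2 * B \<le> e * C" using e by simp
  also have "\<dots> \<le> B / (C + 1) * C" using C by (intro mult_right_mono) (auto simp: e_def)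
  also have "\<dots> \<le> B" using B C by (simp add: field_simps)
  finally show False using B by simp
qed

text \<open>A theorem of the alternative for matching all pairs \<open>v k\<close>,
  \<open>w k\<close> with one matrix. The right side of \<open>dual\<close> is the largest value of
  the functional \<open>y\<close> on images of stochastic matrices, because each column can put all
  its mass on a best row. Hence \<open>dual\<close> says that no functional separates
  \<open>w\<close> from these images.\<close>

lemma stochastic_on_exists:
  fixes v :: "'k \<Rightarrow> 'j \<Rightarrow> real" and w :: "'k \<Rightarrow> 'i \<Rightarrow> real"
  assumes fin: "finite I" "finite J" "finite K" and I: "I \<noteq> {}"
    and dual: "\<And>y. (\<Sum>i\<in>I. \<Sum>k\<in>K. y k i * w k i) \<le> (\<Sum>j\<in>J. MAX i\<in>I. \<Sum>k\<in>K. y k i * v k j)"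
  shows "\<exists>M\<in>stochastic_on I J. \<forall>k\<in>K. \<forall>i\<in>I. (\<Sum>j\<in>J. M (i, j) * v k j) = w k i"
proof -
  define img where "img M k i = (\<Sum>j\<in>J. M (i, j) * v k j)" for M :: "'i \<times> 'j \<Rightarrow> real" and k i
  define Q where "Q M = (\<Sum>i\<in>I. \<Sum>k\<in>K. (w k i - img M k i)\<^sup>2)" for M
  have "\<exists>c. c \<in> I \<and> u c = (MAX i\<in>I. u i)" for u :: "'i \<Rightarrow> real"
  proof -
    have "(MAX i\<in>I. u i) \<in> u ` I" using fin(1) I by (intro Max_in) auto
    then show ?thesis by (metis imageE)
  qed
  then have "\<exists>c. \<forall>j. c j \<in> I \<and> u (c j) j = (MAX i\<in>I. u i j)" for u :: "'i \<Rightarrow> 'j \<Rightarrow> real"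
    by (intro choice allI)
  then obtain c where c: "\<And>(u :: 'i \<Rightarrow> 'j \<Rightarrow> real) j. c u j \<in> I"
      "\<And>(u :: 'i \<Rightarrow> 'j \<Rightarrow> real) j. u (c u j) j = (MAX i\<in>I. u i j)" by metis
  \<comment> \<open>Given scores \<open>u\<close>, this 0-1 matrix sends column \<open>j\<close> to
    a row \<open>c u j\<close> of maximal score.\<close>
  have sel: "(\<lambda>(i, j). if i = c u j then 1 else 0) \<in> stochastic_on I J" for u
    using c(1) fin(1) by (auto simp: stochastic_on_def)
  have "continuous_on (stochastic_on I J) Q"
    unfolding Q_def img_def
    by (intro continuous_intros continuous_on_subset[OF continuous_on_product_coordinates]) auto
  moreover have "stochastic_on I J \<noteq> {}" using sel by blast
  ultimately obtain M where M: "M \<in> stochastic_on I J"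
    and min: "\<And>M'. M' \<in> stochastic_on I J \<Longrightarrow> Q M \<le> Q M'"
    using continuous_attains_inf[OF compact_stochastic_on] by metis
  define y where "y k i = w k i - img M k i" for k i
  define u where "u i j = (\<Sum>k\<in>K. y k i * v k j)" for i j
  define M' where "M' = (\<lambda>(i, j). if i = c u j then 1 else 0 :: real)"
  have M': "M' \<in> stochastic_on I J" unfolding M'_def by (rule sel)
  \<comment> \<open>Moving from the minimizer \<open>M\<close> towards \<open>M'\<close> cannot
    decrease \<open>Q\<close>, and the left side is minus half the derivative of \<open>Q\<close> in
    that direction.\<close>
  have "(\<Sum>i\<in>I. \<Sum>k\<in>K. y k i * (img M' k i - img M k i)) \<le> 0"
  proof (rule first_order_condition)
    show "0 \<le> (\<Sum>i\<in>I. \<Sum>k\<in>K. (img M' k i - img M k i)\<^sup>2)" by (intro sum_nonneg) auto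
    fix e :: real assume e: "0 < e" "e \<le> 1"
    define Me where "Me = (\<lambda>x. (1 - e) * M x + e * M' x)"
    have img: "w k i - img Me k i = y k i - e * (img M' k i - img M k i)" for k i
      by (simp add: img_def Me_def y_def algebra_simps sum.distrib sum_distrib_left sum_subtractf)
    have "Q M \<le> Q Me"
      unfolding Me_def by (rule min, rule stochastic_on_convex_comb) (use M M' e in auto)
    also have "Q Me = Q M - 2 * e * (\<Sum>i\<in>I. \<Sum>k\<in>K. y k i * (img M' k i - img M k i))
        + e\<^sup>2 * (\<Sum>i\<in>I. \<Sum>k\<in>K. (img M' k i - img M k i)\<^sup>2)"
      unfolding Q_def img y_def[symmetric] sum_distrib_left sum_subtractf[symmetric] sum.distrib[symmetric]
      by (intro sum.cong refl) (simp add: power2_eq_square algebra_simps)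
    finally show "2 * e * (\<Sum>i\<in>I. \<Sum>k\<in>K. y k i * (img M' k i - img M k i))
        \<le> e\<^sup>2 * (\<Sum>i\<in>I. \<Sum>k\<in>K. (img M' k i - img M k i)\<^sup>2)" by simp
  qed
  then have "(\<Sum>i\<in>I. \<Sum>k\<in>K. y k i * img M' k i) \<le> (\<Sum>i\<in>I. \<Sum>k\<in>K. y k i * img M k i)"
    by (simp add: right_diff_distrib sum_subtractf)
  moreover have "(\<Sum>i\<in>I. \<Sum>k\<in>K. y k i * img M' k i) = (\<Sum>j\<in>J. MAX i\<in>I. u i j)"
  proof -
    have "(\<Sum>i\<in>I. \<Sum>k\<in>K. y k i * img M' k i) = (\<Sum>i\<in>I. \<Sum>j\<in>J. M' (i, j) * u i j)"
      unfolding img_def u_def sum_distrib_left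
      by (intro sum.cong[OF refl]) (subst sum.swap, simp add: mult_ac)
    also have "\<dots> = (\<Sum>j\<in>J. \<Sum>i\<in>I. M' (i, j) * u i j)" by (rule sum.swap)
    also have "\<dots> = (\<Sum>j\<in>J. u (c u j) j)"
    proof (rule sum.cong[OF refl])
      fix j
      have "(\<Sum>i\<in>I. M' (i, j) * u i j) = (\<Sum>i\<in>I. if i = c u j then u i j else 0)"
        by (rule sum.cong) (auto simp: M'_def)
      then show "(\<Sum>i\<in>I. M' (i, j) * u i j) = u (c u j) j" using c(1) fin(1) by simp
    qed
    finally show ?thesis by (simp only: c(2))
  qed
  moreover have "(\<Sum>i\<in>I. \<Sum>k\<in>K. y k i * w k i) \<le> (\<Sum>j\<in>J. MAX i\<in>I. u i j)"
    unfolding u_def by (rule dual)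
  \<comment> \<open>\<open>Q M\<close> pairs the residual \<open>y\<close> with itself, that is,
    with \<open>w\<close> minus the image of \<open>M\<close>. The value of \<open>y\<close> at
    \<open>w\<close> is at most its maximum, attained at \<open>M'\<close>, which is at most its
    value at the image of \<open>M\<close>; hence \<open>Q M\<close> is at most 0.\<close>
  moreover have "Q M = (\<Sum>i\<in>I. \<Sum>k\<in>K. y k i * w k i) - (\<Sum>i\<in>I. \<Sum>k\<in>K. y k i * img M k i)"
    unfolding Q_def y_def[symmetric]
    by (simp add: sum_subtractf[symmetric] right_diff_distrib[symmetric] y_def[symmetric] power2_eq_square)
  ultimately have "Q M \<le> 0" by linarith
  moreover have "0 \<le> Q M" unfolding Q_def by (intro sum_nonneg) auto
  ultimately have "Q M = 0" by simp
  then have "\<forall>i\<in>I. \<forall>k\<in>K. w k i = img M k i"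
    unfolding Q_def using fin by (simp add: sum_nonneg_eq_0_iff sum_nonneg)
  with M show ?thesis unfolding img_def by (intro bexI[of _ M]) auto
qed

lemma convex_on_Max_affine:
  fixes a b :: "'i \<Rightarrow> real"
  assumes "finite I" "I \<noteq> {}" "convex S"
  shows "convex_on S (\<lambda>t. MAX i\<in>I. a i * t + b i)"
proof (rule convex_onI)
  fix e t t' :: real
  assume e: "0 < e" "e < 1"
  show "(MAX i\<in>I. a i * ((1 - e) *\<^sub>R t + e *\<^sub>R t') + b i)
      \<le> (1 - e) * (MAX i\<in>I. a i * t + b i) + e * (MAX i\<in>I. a i * t' + b i)"
  proof (rule Max.boundedI)
    fix z assume "z \<in> (\<lambda>i. a i * ((1 - e) *\<^sub>R t + e *\<^sub>R t') + b i) ` I"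
    then obtain i where i: "i \<in> I" "z = a i * ((1 - e) *\<^sub>R t + e *\<^sub>R t') + b i" by auto
    have "z = (1 - e) * (a i * t + b i) + e * (a i * t' + b i)"
      by (simp add: i(2) algebra_simps)
    also have "\<dots> \<le> (1 - e) * (MAX i\<in>I. a i * t + b i) + e * (MAX i\<in>I. a i * t' + b i)"
      using assms i(1) e by (intro add_mono mult_left_mono Max_ge) auto
    finally show "z \<le> \<dots>" .
  qed (use assms in auto)
qed (rule assms(3))

text \<open>The two vectors to be matched are indexed by \<open>bool\<close>: \<open>True\<close>
  for \<open>r\<close> and \<open>s\<close>, \<open>False\<close> for \<open>g\<close> and
  \<open>h\<close>. Multiplying a maximum of affine functions of the ratio by the positive weight
  turns it into a maximum of linear functions of the two entries, so \<open>div\<close> yields the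
  dual condition.\<close>

lemma stochastic_on_if_divergence_le:
  fixes r g :: "'j \<Rightarrow> real" and s h :: "'i \<Rightarrow> real"
  assumes fin: "finite J" "finite I" and I: "I \<noteq> {}"
    and g: "\<And>j. j \<in> J \<Longrightarrow> 0 < g j" and h: "\<And>i. i \<in> I \<Longrightarrow> 0 < h i"
    and div: "\<And>f. convex_on {0..} f \<Longrightarrow>
      (\<Sum>i\<in>I. h i * f (s i / h i)) \<le> (\<Sum>j\<in>J. g j * f (r j / g j))"
  shows "\<exists>M\<in>stochastic_on I J.
    (\<forall>i\<in>I. (\<Sum>j\<in>J. M (i, j) * r j) = s i) \<and> (\<forall>i\<in>I. (\<Sum>j\<in>J. M (i, j) * g j) = h i)"
proof -
  have "\<exists>M\<in>stochastic_on I J. \<forall>k\<in>UNIV. \<forall>i\<in>I.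
      (\<Sum>j\<in>J. M (i, j) * (if k then r else g) j) = (if k then s else h) i"
  proof (rule stochastic_on_exists[OF fin(2,1) _ I])
    fix y :: "bool \<Rightarrow> 'i \<Rightarrow> real"
    define F where "F t = (MAX i\<in>I. y True i * t + y False i)" for t
    have F_ge: "y True i * t + y False i \<le> F t" if "i \<in> I" for i t
      unfolding F_def using fin(2) that by (intro Max_ge) auto
    have "(\<Sum>i\<in>I. y True i * s i + y False i * h i) \<le> (\<Sum>i\<in>I. h i * F (s i / h i))"
    proof (rule sum_mono)
      fix i assume i: "i \<in> I"
      have "y True i * s i + y False i * h i = h i * (y True i * (s i / h i) + y False i)"
        using h[OF i] by (simp add: field_simps)
      also have "\<dots> \<le> h i * F (s i / h i)"
        using h[OF i] by (intro mult_left_mono F_ge[OF i]) simp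
      finally show "y True i * s i + y False i * h i \<le> h i * F (s i / h i)" .
    qed
    also have "\<dots> \<le> (\<Sum>j\<in>J. g j * F (r j / g j))"
      unfolding F_def by (intro div convex_on_Max_affine fin I) simp
    also have "\<dots> \<le> (\<Sum>j\<in>J. MAX i\<in>I. y True i * r j + y False i * g j)"
    proof (rule sum_mono)
      fix j assume j: "j \<in> J"
      have "F (r j / g j) \<in> (\<lambda>i. y True i * (r j / g j) + y False i) ` I"
        unfolding F_def using fin(2) I by (intro Max_in) auto
      then obtain i where i: "i \<in> I" "F (r j / g j) = y True i * (r j / g j) + y False i" by auto
      have "g j * F (r j / g j) = y True i * r j + y False i * g j"
        using g[OF j] by (simp add: i(2) field_simps)
      also have "\<dots> \<le> (MAX i\<in>I. y True i * r j + y False i * g j)"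
        using fin(2) i(1) by (intro Max_ge) auto
      finally show "g j * F (r j / g j) \<le> (MAX i\<in>I. y True i * r j + y False i * g j)" .
    qed
    finally show "(\<Sum>i\<in>I. \<Sum>k\<in>UNIV. y k i * (if k then s else h) i)
        \<le> (\<Sum>j\<in>J. MAX i\<in>I. \<Sum>k\<in>UNIV. y k i * (if k then r else g) j)"
      by (simp add: UNIV_bool add.commute)
  qed simp
  then show ?thesis by (simp add: all_bool_eq conj_commute)
qed

section \<open>Lorenz curves\<close>

locale sorted_pair =
  fixes d :: nat and r g :: "nat \<Rightarrow> real"
  assumes d: "0 < d" and g: "\<And>j. j < d \<Longrightarrow> 0 < g j"
    and ratio: "\<And>i j. i \<le> j \<Longrightarrow> j < d \<Longrightarrow> r j / g j \<le> r i / g i"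
begin

abbreviation x :: "nat \<Rightarrow> real" where "x k \<equiv> \<Sum>j<k. g j"
abbreviation y :: "nat \<Rightarrow> real" where "y k \<equiv> \<Sum>j<k. r j"
text \<open>The divergence of the hinge at \<open>a\<close>, with the positive weight
  \<open>g j\<close> moved inside the maximum.\<close>

abbreviation hinge_sum :: "real \<Rightarrow> real" where
  "hinge_sum a \<equiv> \<Sum>j<d. max 0 (r j - a * g j)"

lemma strict_mono_x: "strict_mono_on {..d} x"
proof (rule strict_mono_onI)
  fix a b assume "a \<in> {..d}" "b \<in> {..d}" "a < b"
  then show "x a < x b" using g by (intro sum_strict_mono2[where b = a]) (auto simp: less_imp_le)
qed

text \<open>On segment \<open>k\<close> the two coordinates grow by \<open>g k\<close> and
  \<open>r k\<close>, and \<open>l\<close> is the fraction of the segment already covered at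
  \<open>t\<close>.\<close>

lemma curve_segment:
  assumes "0 \<le> t" "t \<le> x d"
  obtains k l where "k < d" "0 \<le> l" "l \<le> 1" "t = x k + l * g k"
    "piecewise_linear x y t = y k + l * r k"
proof -
  define k where "k = (LEAST k. t \<le> x (Suc k))"
  \<comment> \<open>Since \<open>d\<close> is positive, \<open>Suc (d - 1)\<close> is
    \<open>d\<close>, so the last segment bounds the search for \<open>k\<close>.\<close>
  have ex: "t \<le> x (Suc (d - 1))" using assms d by simp
  have k: "t \<le> x (Suc k)" unfolding k_def by (rule LeastI[of _ "d - 1"], rule ex)
  have "k \<le> d - 1" unfolding k_def by (rule Least_le, rule ex)
  then have kd: "k < d" using d by simp
  have k': "x k \<le> t"
  proof (cases k)
    case (Suc k')
    have "\<not> t \<le> x (Suc k')"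
      by (rule not_less_Least[of k' "\<lambda>k. t \<le> x (Suc k)", folded k_def]) (simp add: Suc)
    then show ?thesis by (simp only: Suc)
  qed (use assms in simp)
  show ?thesis
  proof (rule that[OF kd, of "(t - x k) / g k"])
    show "piecewise_linear x y t = y k + (t - x k) / g k * r k"
      using piecewise_linear_segment[OF strict_mono_x kd k' k, of y] by simp
  qed (use k k' g[OF kd] in \<open>auto simp: field_simps\<close>)
qed

text \<open>The inequality half of the Legendre duality: \<open>L t - a * t\<close> sums the terms
  \<open>r j - a * g j\<close> before \<open>k\<close> and a fraction of term \<open>k\<close>,
  which is at most the sum of all positive parts.\<close>

lemma curve_le:
  assumes "0 \<le> t" "t \<le> x d"
  shows "piecewise_linear x y t \<le> hinge_sum a + a * t"
proof -
  obtain k l where k: "k < d" "0 \<le> l" "l \<le> 1" "t = x k + l * g k"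
    "piecewise_linear x y t = y k + l * r k"
    using curve_segment[OF assms] .
  have "piecewise_linear x y t - a * t = (\<Sum>j<k. r j - a * g j) + l * (r k - a * g k)"
    unfolding k(5) by (simp add: k(4) algebra_simps sum_subtractf sum_distrib_left)
  also have "\<dots> \<le> (\<Sum>j<k. max 0 (r j - a * g j)) + max 0 (r k - a * g k)"
  proof (rule add_mono)
    show "(\<Sum>j<k. r j - a * g j) \<le> (\<Sum>j<k. max 0 (r j - a * g j))"
      by (rule sum_mono) simp
    have "l * (r k - a * g k) \<le> l * max 0 (r k - a * g k)"
      by (intro mult_left_mono k) simp
    also have "\<dots> \<le> 1 * max 0 (r k - a * g k)"
      by (intro mult_right_mono k) simp
    finally show "l * (r k - a * g k) \<le> max 0 (r k - a * g k)" by simp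
  qed
  also have "\<dots> = (\<Sum>j<Suc k. max 0 (r j - a * g j))" by simp
  also have "\<dots> \<le> hinge_sum a"
    using k(1) by (intro sum_mono2) auto
  finally show ?thesis by simp
qed

text \<open>Exactly the first \<open>k\<close> terms can have a positive part. A ratio equal to
  \<open>a\<close> contributes 0, so it may lie on either side of the cut.\<close>

lemma hinge_sum_split:
  assumes k: "k \<le> d" and less: "\<And>j. j < k \<Longrightarrow> a \<le> r j / g j"
    and ge: "\<And>j. k \<le> j \<Longrightarrow> j < d \<Longrightarrow> r j / g j \<le> a"
  shows "hinge_sum a = y k - a * x k"
proof -
  have "hinge_sum a = (\<Sum>j<d. if j \<in> {..<k} then r j - a * g j else 0)"
  proof (rule sum.cong[OF refl])
    fix j assume j: "j \<in> {..<d}"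
    show "max 0 (r j - a * g j) = (if j \<in> {..<k} then r j - a * g j else 0)"
      using less[of j] ge[of j] g[of j] j by (auto simp: field_simps max_def not_less)
  qed
  also have "\<dots> = (\<Sum>j\<in>{..<d} \<inter> {..<k}. r j - a * g j)"
    by (simp add: sum.inter_restrict)
  also have "{..<d} \<inter> {..<k} = {..<k}" using k by auto
  finally show ?thesis by (simp add: sum_subtractf sum_distrib_left)
qed

text \<open>Equality in \<open>curve_le\<close> holds when \<open>a\<close> is the slope
  \<open>r k / g k\<close> of the segment containing \<open>t\<close>: the fractional term then
  vanishes and the sorted ratios split at \<open>k\<close>.\<close>

lemma curve_tangent:
  assumes "0 \<le> t" "t \<le> x d"
  obtains a where "piecewise_linear x y t = hinge_sum a + a * t"
proof -
  obtain k l where k: "k < d" "0 \<le> l" "l \<le> 1" "t = x k + l * g k"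
    "piecewise_linear x y t = y k + l * r k"
    using curve_segment[OF assms] .
  define a where "a = r k / g k"
  have "hinge_sum a = y k - a * x k"
    by (rule hinge_sum_split) (use k(1) ratio in \<open>auto simp: a_def\<close>)
  moreover have "a * g k = r k" using g[OF k(1)] by (simp add: a_def)
  ultimately have "piecewise_linear x y t = hinge_sum a + a * t"
    unfolding k(5) by (simp add: k(4) distrib_left)
  then show ?thesis by (rule that)
qed

lemma curve_knot: "k \<le> d \<Longrightarrow> piecewise_linear x y (x k) = y k"
proof (cases "k < d")
  case True
  then have "x k \<le> x (Suc k)" using g[of k] by simp
  then show ?thesis using piecewise_linear_segment[OF strict_mono_x True, of "x k" y] by simp
next
  case False
  assume "k \<le> d"
  with False d obtain l where l: "k = Suc l" "l < d" by (metis gr0_implies_Suc le_neq_implies_less lessI)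
  have "x l \<le> x (Suc l)" using g[OF l(2)] by simp
  then show ?thesis
    using piecewise_linear_segment[OF strict_mono_x l(2), of "x (Suc l)" y] g[OF l(2)]
    by (simp add: l(1))
qed

text \<open>The maximum of \<open>L t - a * t\<close> is reached at the knot where the slope first
  drops to \<open>a\<close> or below, or at the right end if it never does.\<close>

lemma hinge_sum_attained:
  obtains t where "0 \<le> t" "t \<le> x d" "hinge_sum a = piecewise_linear x y t - a * t"
proof -
  define k where "k = (LEAST k. k = d \<or> r k / g k \<le> a)"
  have k: "k = d \<or> r k / g k \<le> a"
    unfolding k_def by (rule LeastI[of _ d]) simp
  have kd: "k \<le> d" unfolding k_def by (rule Least_le) simp
  have less: "a < r j / g j" if "j < k" for j
    using not_less_Least[of j "\<lambda>k. k = d \<or> r k / g k \<le> a", folded k_def] that by auto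
  have "hinge_sum a = y k - a * x k"
  proof (rule hinge_sum_split[OF kd])
    show "r j / g j \<le> a" if "k \<le> j" "j < d" for j
      using k ratio[OF that] that by auto
  qed (use less in \<open>auto intro: less_imp_le\<close>)
  moreover have "0 \<le> x k" using kd g by (intro sum_nonneg) (auto intro: less_imp_le)
  moreover have "x k \<le> x d" using kd g by (intro sum_mono2) (auto intro: less_imp_le)
  ultimately show ?thesis using that[of "x k"] curve_knot[OF kd] by simp
qed

end

text \<open>Each direction uses an equality case for one pair and \<open>curve_le\<close> for the
  other. The common total \<open>c\<close> makes both curves live on the same interval even if
  \<open>d\<close> and \<open>e\<close> differ.\<close>

lemma curve_ge_iff_hinge_sum_ge:
  assumes R: "sorted_pair d r g" and S: "sorted_pair e s h"
    and eq: "(\<Sum>j<d. g j) = c" "(\<Sum>j<e. h j) = c"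
  shows "(\<forall>t\<in>{0..c}. piecewise_linear (\<lambda>k. \<Sum>j<k. h j) (\<lambda>k. \<Sum>j<k. s j) t
        \<le> piecewise_linear (\<lambda>k. \<Sum>j<k. g j) (\<lambda>k. \<Sum>j<k. r j) t)
    \<longleftrightarrow> (\<forall>a. (\<Sum>j<e. max 0 (s j - a * h j)) \<le> (\<Sum>j<d. max 0 (r j - a * g j)))"
    (is "(\<forall>t\<in>_. ?L t \<le> ?K t) \<longleftrightarrow> (\<forall>a. ?P a \<le> ?Q a)")
proof (intro iffI allI ballI)
  fix a assume le: "\<forall>t\<in>{0..c}. ?L t \<le> ?K t"
  obtain t where t: "0 \<le> t" "t \<le> c" "?P a = ?L t - a * t"
    using sorted_pair.hinge_sum_attained[OF S] eq by metis
  then have "?L t \<le> ?K t" using le by simp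
  also have "\<dots> \<le> ?Q a + a * t" using sorted_pair.curve_le[OF R] t eq by simp
  finally show "?P a \<le> ?Q a" using t(3) by simp
next
  fix t assume le: "\<forall>a. ?P a \<le> ?Q a" and t: "t \<in> {0..c}"
  obtain a where a: "?K t = ?Q a + a * t"
    using sorted_pair.curve_tangent[OF R, of t] t eq by auto
  have "?L t \<le> ?P a + a * t" using sorted_pair.curve_le[OF S] t eq by simp
  also have "\<dots> \<le> ?K t" using le a by simp
  finally show "?L t \<le> ?K t" .
qed

section \<open>States\<close>

lemma is_state_probs:
  assumes "is_state R"
  shows "\<And>i. i < gp_dim R \<Longrightarrow> 0 \<le> probs R $ i" "(\<Sum>i<gp_dim R. probs R $ i) = 1" "0 < gp_dim R"
proof -
  have p: "probability_vec (probs R)" using assms by (simp add: is_state_def Let_def)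
  then show "\<And>i. i < gp_dim R \<Longrightarrow> 0 \<le> probs R $ i" and sum: "(\<Sum>i<gp_dim R. probs R $ i) = 1"
    by (auto simp: probability_vec_def gp_dim_def)
  show "0 < gp_dim R" using sum by (cases "gp_dim R") auto
qed

lemma gibbs_vec_distribution:
  assumes "0 < gp_dim R"
  shows "i < gp_dim R \<Longrightarrow> 0 < gibbs_vec \<beta> \<mu> R $ i" "(\<Sum>i<gp_dim R. gibbs_vec \<beta> \<mu> R $ i) = 1"
proof -
  have Z: "0 < partition_fun \<beta> \<mu> R"
    unfolding partition_fun_def using assms by (intro sum_pos) auto
  then show "i < gp_dim R \<Longrightarrow> 0 < gibbs_vec \<beta> \<mu> R $ i" by (simp add: gibbs_vec_def)
  show "(\<Sum>i<gp_dim R. gibbs_vec \<beta> \<mu> R $ i) = 1"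
    using Z by (simp add: gibbs_vec_def sum_divide_distrib[symmetric] partition_fun_def)
qed

text \<open>The permutation chosen in \<open>lorenz_curve\<close> is fixed once. Divergences are
  invariant under reindexing, so curve and hinge divergences can be read off from the same sorted
  data.\<close>

lemma lorenz_curve_sorted_pair:
  fixes \<beta> \<mu> :: real
  assumes "is_state R"
  obtains r g where "sorted_pair (gp_dim R) r g" "(\<Sum>j<gp_dim R. g j) = 1"
    "lorenz_curve \<beta> \<mu> R = piecewise_linear (\<lambda>k. \<Sum>j<k. g j) (\<lambda>k. \<Sum>j<k. r j)"
    "\<forall>a. f_divergence \<beta> \<mu> (\<lambda>t. max 0 (t - a)) R = (\<Sum>j<gp_dim R. max 0 (r j - a * g j))"
proof -
  define \<pi> where "\<pi> = (SOME \<pi>. sorting_perm \<beta> \<mu> R \<pi>)"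
  have "sorting_perm \<beta> \<mu> R \<pi>"
    unfolding \<pi>_def by (rule someI_ex[OF sorting_perm_exists])
  then have perm: "\<pi> permutes {..<gp_dim R}"
    and ratio: "\<And>i j. i \<le> j \<Longrightarrow> j < gp_dim R \<Longrightarrow>
      probs R $ \<pi> j / gibbs_vec \<beta> \<mu> R $ \<pi> j \<le> probs R $ \<pi> i / gibbs_vec \<beta> \<mu> R $ \<pi> i"
    by (auto simp: sorting_perm_def)
  define r where "r j = probs R $ \<pi> j" for j
  define g where "g j = gibbs_vec \<beta> \<mu> R $ \<pi> j" for j
  note d = is_state_probs(3)[OF assms]
  note G = gibbs_vec_distribution[OF d, where \<beta> = \<beta> and \<mu> = \<mu>]
  have reindex: "(\<Sum>j<gp_dim R. F (\<pi> j)) = (\<Sum>j<gp_dim R. F j)" for F :: "nat \<Rightarrow> real"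
    using sum.permute[OF perm, of F] by (simp add: o_def)
  show ?thesis
  proof (rule that[of r g])
    show "sorted_pair (gp_dim R) r g"
    proof
      show "0 < g j" if "j < gp_dim R" for j
        unfolding g_def using permutes_in_image[OF perm, of j] that by (intro G) simp
    qed (use d ratio in \<open>simp_all add: r_def g_def\<close>)
    show "(\<Sum>j<gp_dim R. g j) = 1" unfolding g_def by (subst reindex) (rule G)
    show "lorenz_curve \<beta> \<mu> R = piecewise_linear (\<lambda>k. \<Sum>j<k. g j) (\<lambda>k. \<Sum>j<k. r j)"
      by (simp add: lorenz_curve_def \<pi>_def[symmetric] r_def g_def)
    show "\<forall>a. f_divergence \<beta> \<mu> (\<lambda>t. max 0 (t - a)) R = (\<Sum>j<gp_dim R. max 0 (r j - a * g j))"
    proof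
      fix a
      have "f_divergence \<beta> \<mu> (\<lambda>t. max 0 (t - a)) R
          = (\<Sum>j<gp_dim R. max 0 (probs R $ j - a * gibbs_vec \<beta> \<mu> R $ j))"
        unfolding f_divergence_def
      proof (rule sum.cong[OF refl])
        fix j assume "j \<in> {..<gp_dim R}"
        then have "0 < gibbs_vec \<beta> \<mu> R $ j" using G by simp
        then show "gibbs_vec \<beta> \<mu> R $ j * max 0 (probs R $ j / gibbs_vec \<beta> \<mu> R $ j - a)
            = max 0 (probs R $ j - a * gibbs_vec \<beta> \<mu> R $ j)"
          by (simp add: max_mult_distrib_left right_diff_distrib mult.commute)
      qed
      then show "f_divergence \<beta> \<mu> (\<lambda>t. max 0 (t - a)) R = (\<Sum>j<gp_dim R. max 0 (r j - a * g j))"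
        unfolding r_def g_def by (subst reindex)
    qed
  qed
qed

lemma lorenz_curve_ge_iff:
  assumes "is_state R" "is_state S"
  shows "(\<forall>t\<in>{0..1}. lorenz_curve \<beta> \<mu> R t \<ge> lorenz_curve \<beta> \<mu> S t)
    \<longleftrightarrow> (\<forall>a. f_divergence \<beta> \<mu> (\<lambda>t. max 0 (t - a)) R \<ge> f_divergence \<beta> \<mu> (\<lambda>t. max 0 (t - a)) S)"
proof -
  obtain r g where R: "sorted_pair (gp_dim R) r g" "(\<Sum>j<gp_dim R. g j) = 1"
    "lorenz_curve \<beta> \<mu> R = piecewise_linear (\<lambda>k. \<Sum>j<k. g j) (\<lambda>k. \<Sum>j<k. r j)"
    "\<forall>a. f_divergence \<beta> \<mu> (\<lambda>t. max 0 (t - a)) R = (\<Sum>j<gp_dim R. max 0 (r j - a * g j))"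
    by (rule lorenz_curve_sorted_pair[OF assms(1), where \<beta> = \<beta> and \<mu> = \<mu>])
  obtain s h where S: "sorted_pair (gp_dim S) s h" "(\<Sum>j<gp_dim S. h j) = 1"
    "lorenz_curve \<beta> \<mu> S = piecewise_linear (\<lambda>k. \<Sum>j<k. h j) (\<lambda>k. \<Sum>j<k. s j)"
    "\<forall>a. f_divergence \<beta> \<mu> (\<lambda>t. max 0 (t - a)) S = (\<Sum>j<gp_dim S. max 0 (s j - a * h j))"
    by (rule lorenz_curve_sorted_pair[OF assms(2), where \<beta> = \<beta> and \<mu> = \<mu>])
  show ?thesis
    unfolding R(3) S(3) R(4)[rule_format] S(4)[rule_format] by (rule curve_ge_iff_hinge_sum_ge[OF R(1) S(1) R(2) S(2)])
qed

section \<open>Equimajorization of states and divergences\<close>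

lemma mult_mat_vec_eq_iff:
  fixes M :: "real mat"
  assumes "M \<in> carrier_mat n m" "v \<in> carrier_vec m" "w \<in> carrier_vec n"
  shows "M *\<^sub>v v = w \<longleftrightarrow> (\<forall>i<n. (\<Sum>j<m. M $$ (i, j) * v $ j) = w $ i)"
proof -
  have "(M *\<^sub>v v) $ i = (\<Sum>j\<in>{0..<m}. M $$ (i, j) * v $ j)" if "i < n" for i
    using that assms by (simp add: scalar_prod_def)
  then have "(M *\<^sub>v v) $ i = (\<Sum>j<m. M $$ (i, j) * v $ j)" if "i < n" for i
    using that by (simp only: atLeast0LessThan)
  moreover have "dim_vec (M *\<^sub>v v) = n" "dim_vec w = n" using assms by auto
  ultimately show ?thesis unfolding vec_eq_iff by (simp del: index_mult_mat_vec)
qed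

lemma gp_carrier:
  "probs R \<in> carrier_vec (gp_dim R)" "gibbs_vec \<beta> \<mu> R \<in> carrier_vec (gp_dim R)"
proof -
  show "probs R \<in> carrier_vec (gp_dim R)" by (rule carrier_vecI) (simp add: gp_dim_def)
  show "gibbs_vec \<beta> \<mu> R \<in> carrier_vec (gp_dim R)" unfolding gibbs_vec_def by (rule vec_carrier)
qed

lemma f_divergence_mono:
  assumes R: "is_state R" and S: "is_state S" and eq: "equimajorizes \<beta> \<mu> R S"
    and f: "convex_on {0..} f"
  shows "f_divergence \<beta> \<mu> f S \<le> f_divergence \<beta> \<mu> f R"
proof -
  obtain M where M: "M \<in> carrier_mat (gp_dim S) (gp_dim R)" "stochastic_mat M"
    "M *\<^sub>v probs R = probs S" "M *\<^sub>v gibbs_vec \<beta> \<mu> R = gibbs_vec \<beta> \<mu> S"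
    using eq by (auto simp: equimajorizes_def)
  show ?thesis
    unfolding f_divergence_def
  proof (rule divergence_mono_stochastic[where M = "\<lambda>i j. M $$ (i, j)"])
    show "0 \<le> M $$ (i, j)" if "i \<in> {..<gp_dim S}" "j \<in> {..<gp_dim R}" for i j
      using M(1,2) that by (simp add: stochastic_mat_def)
    show "(\<Sum>i<gp_dim S. M $$ (i, j)) = 1" if "j \<in> {..<gp_dim R}" for j
      using M(1,2) that by (simp add: stochastic_mat_def)
    show "probs S $ i = (\<Sum>j<gp_dim R. M $$ (i, j) * probs R $ j)" if "i \<in> {..<gp_dim S}" for i
      using M(3) that by (simp add: mult_mat_vec_eq_iff[OF M(1) gp_carrier(1) gp_carrier(1)])
    show "gibbs_vec \<beta> \<mu> S $ i = (\<Sum>j<gp_dim R. M $$ (i, j) * gibbs_vec \<beta> \<mu> R $ j)"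
      if "i \<in> {..<gp_dim S}" for i
      using M(4) that by (simp add: mult_mat_vec_eq_iff[OF M(1) gp_carrier(2) gp_carrier(2)])
  qed (use f in \<open>simp_all add: is_state_probs[OF R] is_state_probs[OF S] gibbs_vec_distribution(1)\<close>)
qed

lemma equimajorizes_if_hinges_le:
  assumes R: "is_state R" and S: "is_state S"
    and le: "\<And>a. f_divergence \<beta> \<mu> (\<lambda>t. max 0 (t - a)) S \<le> f_divergence \<beta> \<mu> (\<lambda>t. max 0 (t - a)) R"
  shows "equimajorizes \<beta> \<mu> R S"
proof -
  define m n where "m = gp_dim R" and "n = gp_dim S"
  note PR = is_state_probs[OF R, folded m_def] and PS = is_state_probs[OF S, folded n_def]
  note GR = gibbs_vec_distribution[OF is_state_probs(3)[OF R], where \<beta> = \<beta> and \<mu> = \<mu>, folded m_def]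
    and GS = gibbs_vec_distribution[OF is_state_probs(3)[OF S], where \<beta> = \<beta> and \<mu> = \<mu>, folded n_def]
  have "\<exists>M\<in>stochastic_on {..<n} {..<m}.
    (\<forall>i\<in>{..<n}. (\<Sum>j\<in>{..<m}. M (i, j) * probs R $ j) = probs S $ i) \<and>
    (\<forall>i\<in>{..<n}. (\<Sum>j\<in>{..<m}. M (i, j) * gibbs_vec \<beta> \<mu> R $ j) = gibbs_vec \<beta> \<mu> S $ i)"
  \<comment> \<open>The hinge inequalities are first extended to all convex functions, which include
    the maxima of affine functions needed for separation.\<close>
  proof (rule stochastic_on_if_divergence_le)
    fix f :: "real \<Rightarrow> real" assume f: "convex_on {0..} f"
    show "(\<Sum>i<n. gibbs_vec \<beta> \<mu> S $ i * f (probs S $ i / gibbs_vec \<beta> \<mu> S $ i))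
        \<le> (\<Sum>j<m. gibbs_vec \<beta> \<mu> R $ j * f (probs R $ j / gibbs_vec \<beta> \<mu> R $ j))"
    proof (rule divergence_le_if_hinges_le)
      show "(\<Sum>i<n. gibbs_vec \<beta> \<mu> S $ i * max 0 (probs S $ i / gibbs_vec \<beta> \<mu> S $ i - a))
          \<le> (\<Sum>j<m. gibbs_vec \<beta> \<mu> R $ j * max 0 (probs R $ j / gibbs_vec \<beta> \<mu> R $ j - a))" for a
        using le[of a] by (simp add: f_divergence_def m_def n_def)
    qed (use f in \<open>simp_all add: PR PS GR GS\<close>)
  next
    show "{..<n} \<noteq> {}" using PS(3) by auto
  qed (simp_all add: GR GS)
  then obtain F where F: "F \<in> stochastic_on {..<n} {..<m}"
    "\<forall>i<n. (\<Sum>j<m. F (i, j) * probs R $ j) = probs S $ i"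
    "\<forall>i<n. (\<Sum>j<m. F (i, j) * gibbs_vec \<beta> \<mu> R $ j) = gibbs_vec \<beta> \<mu> S $ i"
    by auto
  define M where "M = mat n m F"
  have M: "M \<in> carrier_mat n m" by (simp add: M_def)
  have "stochastic_mat M"
    using F(1) by (auto simp: stochastic_mat_def M_def stochastic_on_def)
  moreover have "M *\<^sub>v probs R = probs S"
    using F(2) mult_mat_vec_eq_iff[OF M, of "probs R" "probs S"] gp_carrier
    by (simp add: M_def m_def n_def)
  moreover have "M *\<^sub>v gibbs_vec \<beta> \<mu> R = gibbs_vec \<beta> \<mu> S"
    using F(3) mult_mat_vec_eq_iff[OF M, of "gibbs_vec \<beta> \<mu> R" "gibbs_vec \<beta> \<mu> S"] gp_carrier
    by (simp add: M_def m_def n_def)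
  ultimately show ?thesis
    using M unfolding equimajorizes_def m_def n_def by blast
qed

text \<open>A hinge is the maximum of the two affine functions 0 and \<open>t - a\<close>, indexed
  here by \<open>bool\<close>.\<close>

lemma convex_on_hinge: "convex_on {0..} (\<lambda>t::real. max 0 (t - a))"
proof -
  have "(MAX i\<in>UNIV. of_bool i * t + (if i then - a else 0)) = max 0 (t - a)" for t :: real
    by (simp add: UNIV_bool)
  then show ?thesis
    using convex_on_Max_affine[of "UNIV :: bool set" "{0..}" of_bool "\<lambda>i. if i then - a else 0"] by simp
qed

theorem proposition3:
  fixes \<beta> \<mu> :: real and R S :: gp_state
  assumes "is_state R" and "is_state S"
  shows "(equimajorizes \<beta> \<mu> R S \<longleftrightarrow>
            (\<forall>t\<in>{0..1}. lorenz_curve \<beta> \<mu> R t \<ge> lorenz_curve \<beta> \<mu> S t))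
       \<and> (equimajorizes \<beta> \<mu> R S \<longleftrightarrow>
            (\<forall>a::real. f_divergence \<beta> \<mu> (\<lambda>t. max 0 (t - a)) R
                     \<ge> f_divergence \<beta> \<mu> (\<lambda>t. max 0 (t - a)) S))
       \<and> (equimajorizes \<beta> \<mu> R S \<longleftrightarrow>
            (\<forall>f::real \<Rightarrow> real. continuous_on {0..} f \<and> convex_on {0..} f \<longrightarrow>
               f_divergence \<beta> \<mu> f R \<ge> f_divergence \<beta> \<mu> f S))"
proof -
  let ?hinge = "\<lambda>a t. max 0 (t - a) :: real"
  \<comment> \<open>Hinges are thereby among the continuous convex test functions, so the condition
    on all of these implies the hinge condition.\<close>
  have "continuous_on {0..} (?hinge a)" for a
    by (intro continuous_intros)
  then have hinge: "continuous_on {0..} (?hinge a) \<and> convex_on {0..} (?hinge a)" for a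
    using convex_on_hinge by blast
  have "equimajorizes \<beta> \<mu> R S \<longleftrightarrow>
      (\<forall>a. f_divergence \<beta> \<mu> (?hinge a) R \<ge> f_divergence \<beta> \<mu> (?hinge a) S)"
    using f_divergence_mono[OF assms] equimajorizes_if_hinges_le[OF assms] convex_on_hinge by blast
  moreover have "equimajorizes \<beta> \<mu> R S \<longleftrightarrow>
      (\<forall>f. continuous_on {0..} f \<and> convex_on {0..} f \<longrightarrow> f_divergence \<beta> \<mu> f R \<ge> f_divergence \<beta> \<mu> f S)"
    using f_divergence_mono[OF assms] equimajorizes_if_hinges_le[OF assms] hinge by blast
  ultimately show ?thesis
    unfolding lorenz_curve_ge_iff[OF assms] by blast
qed

end
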